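(* Let $(M^2,g)$ be a surface with a metric $g=E\,du^2+2F\,du\,dv+G\,dv^2$ defined by some solution $(E,F,G)$ of the system $$\begin{array}{l} 2EF_u-FE_u-EE_v=0,\\ 2GF_v-FG_v-GG_u=0,\\ GE_u+EG_v-2F(F_u+F_v)+(3F-2G)E_v+(3F-2E)G_u=0.\end{array}$$ Then for any vector field $X$ in the linear span of $\partial_u,\ \partial_v,\ u\partial_u+v\partial_v,\ E\partial_E+F\partial_F+G\partial_G$, the map $\tilde\varphi_t:(M^2,g)\to(M^2_t,g_t)$ induced by the exponential $\varphi_t=\exp(tX)$ is projective. Moreover, if this map is not an isometry then it is a homothety.
   Context: All considerations are local. A solution $(E,F,G)$ (with $E>0$, $EG-F^2>0$) defines the surface $\Sigma=\{(u,v,E(u,v),F(u,v),G(u,v))\}\subset\mathbb R^5$. For a vector field $X$ as in the claim, its local flow $\varphi_t$ on $\mathbb R^5$ maps $\Sigma$, for sufficiently small $t$, to a surface $\Sigma_t$ that is the graph of another solution $(E_t,F_t,G_t)$ of the same system; $(M^2_t,g_t)$ denotes the surface with metric $g_t=E_t\,du^2+2F_t\,du\,dv+G_t\,dv^2$. The induced map $\tilde\varphi_t$ sends $(u,v)$ to the projection to the $(u,v)$-plane of $\varphi_t(u,v,E(u,v),F(u,v),G(u,v))$. A map $\varphi:(M^2,g)\to(\tilde M^2,\tilde g)$ is projective if it sends unparametrized geodesics of $(M^2,g)$ to unparametrized geodesics of $(\tilde M^2,\tilde g)$. A projective map is a homothety if $\varphi^*\tilde g=\mathrm{const}\cdot g$.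 *)

theory Defs
  imports "HOL-Analysis.Analysis"
begin

section \<open>Smooth maps\<close>

text \<open>\<open>Ck_on k U f\<close> is only meant for open \<open>U\<close>.\<close>

primrec Ck_on ::
  "nat \<Rightarrow> 'a::euclidean_space set \<Rightarrow> ('a \<Rightarrow> 'b::real_normed_vector) \<Rightarrow> bool"
where
  "Ck_on 0 U f \<longleftrightarrow> continuous_on U f"
| "Ck_on (Suc k) U f \<longleftrightarrow>
     (\<forall>x\<in>U. f differentiable (at x)) \<and>
     (\<forall>b\<in>Basis. Ck_on k U (\<lambda>x. frechet_derivative f (at x) b))"

definition smooth_on :: "'a::euclidean_space set \<Rightarrow> ('a \<Rightarrow> 'b::real_normed_vector) \<Rightarrow> bool"
  where "smooth_on U f \<longleftrightarrow> (\<forall>k. Ck_on k U f)"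

definition partial :: "'n::finite \<Rightarrow> (real^'n \<Rightarrow> real) \<Rightarrow> real^'n \<Rightarrow> real"
  where "partial i f p = frechet_derivative f (at p) (axis i 1)"


section \<open>Riemannian metrics on open subsets of coordinate space\<close>

text \<open>A metric is given by its Gram matrix in the standard coordinates.\<close>

definition christoffel ::
  "(real^'n \<Rightarrow> real^'n^'n) \<Rightarrow> 'n::finite \<Rightarrow> 'n \<Rightarrow> 'n \<Rightarrow> real^'n \<Rightarrow> real"
where
  "christoffel g k i j p =
     (\<Sum>l\<in>UNIV. matrix_inv (g p) $ k $ l *
        (partial i (\<lambda>q. g q $ j $ l) p + partial j (\<lambda>q. g q $ i $ l) p
          - partial l (\<lambda>q. g q $ i $ j) p)) / 2"

definition open_interval :: "real set \<Rightarrow> bool"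
  where "open_interval I \<longleftrightarrow> open I \<and> connected I \<and> I \<noteq> {}"

definition geodesic_on ::
  "(real^'n::finite) set \<Rightarrow> (real^'n \<Rightarrow> real^'n^'n) \<Rightarrow> real set \<Rightarrow> (real \<Rightarrow> real^'n) \<Rightarrow> bool"
where
  "geodesic_on U g I \<gamma> \<longleftrightarrow> \<gamma> ` I \<subseteq> U \<and>
     (\<exists>\<gamma>' \<gamma>''. \<forall>s\<in>I.
        (\<gamma> has_vector_derivative \<gamma>' s) (at s) \<and>
        (\<gamma>' has_vector_derivative \<gamma>'' s) (at s) \<and>
        (\<forall>k. \<gamma>'' s $ k +
              (\<Sum>i\<in>UNIV. \<Sum>j\<in>UNIV. christoffel g k i j (\<gamma> s) * \<gamma>' s $ i * \<gamma>' s $ j) = 0))"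

text \<open>
  A parametrized curve represents an unparametrized geodesic if some smooth regular change of
  parameter turns it into a nonconstant (hence nowhere stationary) geodesic.
\<close>

definition unparametrized_geodesic ::
  "(real^'n::finite) set \<Rightarrow> (real^'n \<Rightarrow> real^'n^'n) \<Rightarrow> real set \<Rightarrow> (real \<Rightarrow> real^'n) \<Rightarrow> bool"
where
  "unparametrized_geodesic U g I c \<longleftrightarrow> open_interval I \<and>
     (\<exists>J \<tau>. open_interval J \<and> bij_betw \<tau> J I \<and>
        smooth_on J \<tau> \<and> (\<forall>s\<in>J. deriv \<tau> s \<noteq> 0) \<and>
        geodesic_on U g J (c \<circ> \<tau>) \<and>
        (\<forall>s\<in>J. vector_derivative (c \<circ> \<tau>) (at s) \<noteq> 0))"

definition projective_map ::
  "(real^'n::finite) set \<Rightarrow> (real^'n \<Rightarrow> real^'n^'n) \<Rightarrow>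
   (real^'n) set \<Rightarrow> (real^'n \<Rightarrow> real^'n^'n) \<Rightarrow> (real^'n \<Rightarrow> real^'n) \<Rightarrow> bool"
where
  "projective_map U g V h \<phi> \<longleftrightarrow> smooth_on U \<phi> \<and> \<phi> ` U \<subseteq> V \<and>
     (\<forall>I c. unparametrized_geodesic U g I c \<longrightarrow> unparametrized_geodesic V h I (\<phi> \<circ> c))"

definition pullback_metric ::
  "(real^'n \<Rightarrow> real^'n) \<Rightarrow> (real^'n \<Rightarrow> real^'n^'n) \<Rightarrow> real^'n::finite \<Rightarrow> real^'n^'n"
where
  "pullback_metric \<phi> h p =
     (let A = matrix (frechet_derivative \<phi> (at p)) in transpose A ** h (\<phi> p) ** A)"

definition isometry_map ::
  "(real^'n::finite) set \<Rightarrow> (real^'n \<Rightarrow> real^'n^'n) \<Rightarrow>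
   (real^'n) set \<Rightarrow> (real^'n \<Rightarrow> real^'n^'n) \<Rightarrow> (real^'n \<Rightarrow> real^'n) \<Rightarrow> bool"
where
  "isometry_map U g V h \<phi> \<longleftrightarrow> smooth_on U \<phi> \<and> bij_betw \<phi> U V \<and>
     (\<forall>p\<in>U. pullback_metric \<phi> h p = g p)"

definition homothety_map ::
  "(real^'n::finite) set \<Rightarrow> (real^'n \<Rightarrow> real^'n^'n) \<Rightarrow>
   (real^'n) set \<Rightarrow> (real^'n \<Rightarrow> real^'n^'n) \<Rightarrow> (real^'n \<Rightarrow> real^'n) \<Rightarrow> bool"
where
  "homothety_map U g V h \<phi> \<longleftrightarrow> projective_map U g V h \<phi> \<and>
     (\<exists>c. \<forall>p\<in>U. pullback_metric \<phi> h p = c *\<^sub>R g p)"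


section \<open>The system and its solution surfaces\<close>

text \<open>In the plane with coordinates \<open>(u, v)\<close>, index 1 stands for \<open>u\<close> and index 2 for \<open>v\<close>.\<close>

definition metric_of ::
  "(real^2 \<Rightarrow> real) \<Rightarrow> (real^2 \<Rightarrow> real) \<Rightarrow> (real^2 \<Rightarrow> real) \<Rightarrow> real^2 \<Rightarrow> real^2^2"
where
  "metric_of E F G p = vector [vector [E p, F p], vector [F p, G p]]"

definition metric_solution ::
  "(real^2) set \<Rightarrow> (real^2 \<Rightarrow> real) \<Rightarrow> (real^2 \<Rightarrow> real) \<Rightarrow> (real^2 \<Rightarrow> real) \<Rightarrow> bool"
where
  "metric_solution U E F G \<longleftrightarrow>
     open U \<and> smooth_on U E \<and> smooth_on U F \<and> smooth_on U G \<and>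
     (\<forall>p\<in>U. E p > 0 \<and> E p * G p - (F p)\<^sup>2 > 0) \<and>
     (\<forall>p\<in>U.
        2 * E p * partial 1 F p - F p * partial 1 E p - E p * partial 2 E p = 0 \<and>
        2 * G p * partial 2 F p - F p * partial 2 G p - G p * partial 1 G p = 0 \<and>
        G p * partial 1 E p + E p * partial 2 G p - 2 * F p * (partial 1 F p + partial 2 F p)
          + (3 * F p - 2 * G p) * partial 2 E p + (3 * F p - 2 * E p) * partial 1 G p = 0)"

text \<open>
  The five-dimensional space with coordinates \<open>(u, v, E, F, G)\<close>; the first two
  coordinates are grouped together, so that \<open>fst\<close> is the projection to the \<open>(u, v)\<close>-plane.
\<close>

type_synonym jet = "(real^2) \<times> real \<times> real \<times> real"

definition graph_point ::
  "(real^2 \<Rightarrow> real) \<Rightarrow> (real^2 \<Rightarrow> real) \<Rightarrow> (real^2 \<Rightarrow> real) \<Rightarrow> real^2 \<Rightarrow> jet"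
  where "graph_point E F G p = (p, E p, F p, G p)"

definition surface ::
  "(real^2) set \<Rightarrow> (real^2 \<Rightarrow> real) \<Rightarrow> (real^2 \<Rightarrow> real) \<Rightarrow> (real^2 \<Rightarrow> real) \<Rightarrow> jet set"
  where "surface U E F G = graph_point E F G ` U"


section \<open>Vector fields and their flows\<close>

text \<open>\<open>exp_flow X t\<close> is the time-\<open>t\<close> flow \<open>exp(tX)\<close>.\<close>

definition exp_flow :: "('a::real_normed_vector \<Rightarrow> 'a) \<Rightarrow> real \<Rightarrow> 'a \<Rightarrow> 'a"
where
  "exp_flow X t z = (THE w. \<exists>\<gamma>. \<gamma> 0 = z \<and> \<gamma> t = w \<and>
     (\<forall>s\<in>closed_segment 0 t.
        (\<gamma> has_vector_derivative X (\<gamma> s)) (at s within closed_segment 0 t)))"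

definition field_u :: "jet \<Rightarrow> jet"
  where "field_u = (\<lambda>(p, e, f, g). (axis 1 1, 0, 0, 0))"

definition field_v :: "jet \<Rightarrow> jet"
  where "field_v = (\<lambda>(p, e, f, g). (axis 2 1, 0, 0, 0))"

definition field_dilation :: "jet \<Rightarrow> jet"
  where "field_dilation = (\<lambda>(p, e, f, g). (p, 0, 0, 0))"

definition field_scaling :: "jet \<Rightarrow> jet"
  where "field_scaling = (\<lambda>(p, e, f, g). (0, e, f, g))"

text \<open>Function types carry no \<open>real_vector\<close> instance, so the linear span is written out.\<close>

definition symmetry_fields :: "(jet \<Rightarrow> jet) set"
where
  "symmetry_fields = {X. \<exists>a b c d. X = (\<lambda>z.
     a *\<^sub>R field_u z + b *\<^sub>R field_v z + c *\<^sub>R field_dilation z + d *\<^sub>R field_scaling z)}"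

definition induced_map ::
  "(jet \<Rightarrow> jet) \<Rightarrow> real \<Rightarrow> (real^2 \<Rightarrow> real) \<Rightarrow> (real^2 \<Rightarrow> real) \<Rightarrow> (real^2 \<Rightarrow> real) \<Rightarrow>
   real^2 \<Rightarrow> real^2"
  where "induced_map X t E F G p = fst (exp_flow X t (graph_point E F G p))"

end

theory Submission
  imports Defs
begin

text \<open>
  The flow of a field in the span acts by \<open>(p, z) \<mapsto> (\<mu> p + q, \<lambda> z)\<close> with constants
  \<open>\<mu>, \<lambda> > 0\<close>. Hence \<open>g\<^sub>t (\<mu> p + q) = \<lambda> g p\<close>: first derivatives get multiplied by \<open>\<lambda> / \<mu>\<close>, so the
  system, being quadratic with one derivative in each term, is multiplied by \<open>\<lambda>\<^sup>2 / \<mu>\<close>, while the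
  Christoffel symbols are divided by \<open>\<mu>\<close>. The induced map is \<open>p \<mapsto> \<mu> p + q\<close>, which therefore
  preserves even the parametrized geodesics and pulls \<open>g\<^sub>t\<close> back to \<open>\<mu>\<^sup>2 \<lambda> g\<close>.
\<close>

section \<open>Smooth maps and affine scalings\<close>

lemma open_affine_image:
  fixes U :: "'a::real_normed_vector set"
  assumes "open U" "m \<noteq> 0"
  shows "open ((\<lambda>x. m *\<^sub>R x + q) ` U)"
proof -
  have "(\<lambda>x. m *\<^sub>R x + q) ` U = (+) q ` (*\<^sub>R) m ` U"
    by (auto simp: image_image add.commute)
  then show ?thesis
    using assms by (simp add: open_scaling open_translation)
qed

text \<open>On the image of \<open>U\<close>, which is open, \<open>h\<close> agrees with
  \<open>l *\<^sub>R f (inverse m *\<^sub>R (y - q))\<close> as a function of \<open>y\<close>. The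
  chain rule gives the factor \<open>inverse m\<close> and linearity of \<open>D\<close> pulls it
  out. Values of \<open>h\<close> elsewhere cannot affect the derivative.\<close>

lemma has_derivative_affine_conj:
  fixes f h :: "'a::real_normed_vector \<Rightarrow> 'b::real_normed_vector"
  assumes U: "open U" "p \<in> U" and m: "m \<noteq> 0"
    and h: "\<And>x. x \<in> U \<Longrightarrow> h (m *\<^sub>R x + q) = l *\<^sub>R f x"
    and D: "(f has_derivative D) (at p)"
  shows "(h has_derivative (\<lambda>v. (l / m) *\<^sub>R D v)) (at (m *\<^sub>R p + q))"
proof (rule has_derivative_transform_within_open)
  let ?s = "\<lambda>y. inverse m *\<^sub>R (y - q)"
  have "(f has_derivative D) (at (?s (m *\<^sub>R p + q)))"
    using D m by simp
  then have "((\<lambda>y. f (?s y)) has_derivative (\<lambda>v. D (inverse m *\<^sub>R v))) (at (m *\<^sub>R p + q))"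
    by (rule has_derivative_compose[rotated]) (auto intro!: derivative_eq_intros)
  then have "((\<lambda>y. l *\<^sub>R f (?s y)) has_derivative (\<lambda>v. l *\<^sub>R D (inverse m *\<^sub>R v)))
      (at (m *\<^sub>R p + q))"
    by (rule has_derivative_scaleR_right)
  moreover have "l *\<^sub>R D (inverse m *\<^sub>R v) = (l / m) *\<^sub>R D v" for v
    using linear_scale[OF has_derivative_linear[OF D]] by (simp add: field_simps)
  ultimately show "((\<lambda>y. l *\<^sub>R f (?s y)) has_derivative (\<lambda>v. (l / m) *\<^sub>R D v)) (at (m *\<^sub>R p + q))"
    by simp
  show "open ((\<lambda>x. m *\<^sub>R x + q) ` U)"
    using U(1) m by (rule open_affine_image)
  show "m *\<^sub>R p + q \<in> (\<lambda>x. m *\<^sub>R x + q) ` U"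
    using U by blast
  show "l *\<^sub>R f (?s y) = h y" if "y \<in> (\<lambda>x. m *\<^sub>R x + q) ` U" for y
    using that h m by auto
qed

lemma differentiable_affine_conj:
  fixes f h :: "'a::real_normed_vector \<Rightarrow> 'b::real_normed_vector"
  assumes "open U" "p \<in> U" "m \<noteq> 0"
    and "\<And>x. x \<in> U \<Longrightarrow> h (m *\<^sub>R x + q) = l *\<^sub>R f x"
    and "f differentiable (at p)"
  shows "h differentiable (at (m *\<^sub>R p + q))"
    and "frechet_derivative h (at (m *\<^sub>R p + q)) v = (l / m) *\<^sub>R frechet_derivative f (at p) v"
proof -
  have D: "(h has_derivative (\<lambda>v. (l / m) *\<^sub>R frechet_derivative f (at p) v)) (at (m *\<^sub>R p + q))"
    using assms(1-4) assms(5)[unfolded frechet_derivative_works]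
    by (rule has_derivative_affine_conj)
  then show "h differentiable (at (m *\<^sub>R p + q))"
    by (auto simp: differentiable_def)
  show "frechet_derivative h (at (m *\<^sub>R p + q)) v = (l / m) *\<^sub>R frechet_derivative f (at p) v"
    using frechet_derivative_at[OF D] by metis
qed

text \<open>Induction on \<open>k\<close>: a directional derivative of \<open>h\<close> is related
  to that of \<open>f\<close> by the same affine change of variable, with \<open>l\<close> replaced
  by \<open>l / m\<close>. Hence \<open>l\<close> is generalized along with \<open>f\<close> and
  \<open>h\<close>, while \<open>m\<close> and \<open>q\<close> stay fixed.\<close>

lemma Ck_on_affine_conj:
  fixes f h :: "'a::euclidean_space \<Rightarrow> 'b::real_normed_vector"
  assumes "open U" "m \<noteq> 0"
    and "\<And>x. x \<in> U \<Longrightarrow> h (m *\<^sub>R x + q) = l *\<^sub>R f x"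
    and "Ck_on k U f"
  shows "Ck_on k ((\<lambda>x. m *\<^sub>R x + q) ` U) h"
  using assms(3,4)
proof (induction k arbitrary: f h l)
  case 0
  have "continuous_on ((\<lambda>x. m *\<^sub>R x + q) ` U) (\<lambda>y. l *\<^sub>R f (inverse m *\<^sub>R (y - q)))"
  proof (rule continuous_on_scaleR[OF continuous_on_const continuous_on_compose2[of U f]])
    show "continuous_on U f" using 0(2) by simp
    show "continuous_on ((\<lambda>x. m *\<^sub>R x + q) ` U) (\<lambda>y. inverse m *\<^sub>R (y - q))"
      by (intro continuous_intros)
    show "(\<lambda>y. inverse m *\<^sub>R (y - q)) ` (\<lambda>x. m *\<^sub>R x + q) ` U \<subseteq> U"
      using assms(2) by auto
  qed
  then have "continuous_on ((\<lambda>x. m *\<^sub>R x + q) ` U) h"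
    by (rule continuous_on_eq) (use 0(1) assms(2) in auto)
  then show ?case
    by simp
next
  case (Suc k)
  have diff: "f differentiable (at x)" if "x \<in> U" for x
    using Suc.prems(2) that by simp
  note conj = differentiable_affine_conj[OF assms(1) _ assms(2) Suc.prems(1) diff]
  have "Ck_on k ((\<lambda>x. m *\<^sub>R x + q) ` U) (\<lambda>y. frechet_derivative h (at y) b)"
    if "b \<in> Basis" for b
  proof (rule Suc.IH)
    show "frechet_derivative h (at (m *\<^sub>R x + q)) b = (l / m) *\<^sub>R frechet_derivative f (at x) b"
      if "x \<in> U" for x
      using that by (intro conj)
    show "Ck_on k U (\<lambda>x. frechet_derivative f (at x) b)"
      using Suc.prems(2) \<open>b \<in> Basis\<close> by simp
  qed
  moreover have "\<forall>y\<in>(\<lambda>x. m *\<^sub>R x + q) ` U. h differentiable (at y)"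
    using conj(1) by blast
  ultimately show ?case
    by simp
qed

lemma smooth_on_affine_conj:
  fixes f h :: "'a::euclidean_space \<Rightarrow> 'b::real_normed_vector"
  assumes "open U" "m \<noteq> 0"
    and "\<And>x. x \<in> U \<Longrightarrow> h (m *\<^sub>R x + q) = l *\<^sub>R f x"
    and "smooth_on U f"
  shows "smooth_on ((\<lambda>x. m *\<^sub>R x + q) ` U) h"
  using assms Ck_on_affine_conj unfolding smooth_on_def by blast

lemma smooth_on_imp_differentiable:
  "smooth_on U f \<Longrightarrow> p \<in> U \<Longrightarrow> f differentiable (at p)"
  unfolding smooth_on_def by (metis Ck_on.simps(2))

lemma Ck_on_const: "Ck_on k U (\<lambda>x. c)"
  by (induction k arbitrary: c) simp_all

text \<open>The derivative does not depend on the point, so after one differentiation only constants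
  remain; a case distinction on \<open>k\<close> suffices.\<close>

lemma smooth_on_affine:
  fixes q :: "'a::euclidean_space"
  shows "smooth_on U (\<lambda>x. m *\<^sub>R x + q)"
proof -
  have D: "((\<lambda>x. m *\<^sub>R x + q) has_derivative (*\<^sub>R) m) (at x)" for x
    by (auto intro!: derivative_eq_intros)
  have "Ck_on k U (\<lambda>x. m *\<^sub>R x + q)" for k
  proof (cases k)
    case 0
    then show ?thesis by (simp add: continuous_intros)
  next
    case (Suc n)
    then show ?thesis
      using D by (auto simp: frechet_derivative_at[OF D, symmetric] Ck_on_const differentiable_def)
  qed
  then show ?thesis by (simp add: smooth_on_def)
qed

lemma partial_affine_conj:
  assumes "open U" "p \<in> U" "m \<noteq> 0"
    and "\<And>x. x \<in> U \<Longrightarrow> h (m *\<^sub>R x + q) = l * f x"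
    and "f differentiable (at p)"
  shows "partial i h (m *\<^sub>R p + q) = l / m * partial i f p"
  unfolding partial_def
  using differentiable_affine_conj(2)[of U p m h q l f] assms by simp


section \<open>Metrics and geodesics under affine scalings\<close>

text \<open>\<open>matrix_inv\<close> is a Hilbert choice of a two-sided inverse; invertibility
  supplies the witness for that choice.\<close>

lemma invertible_matrix_inv:
  assumes "invertible A"
  shows "A ** matrix_inv A = mat 1" "matrix_inv A ** A = mat 1"
  using someI_ex[OF assms[unfolded invertible_def]] by (simp_all add: matrix_inv_def)

text \<open>A left inverse and a right inverse of the same matrix coincide, by
  associativity.\<close>

lemma matrix_inv_scaleR:
  fixes A :: "real^'n^'n"
  assumes "invertible A" "l \<noteq> 0"
  shows "matrix_inv (l *\<^sub>R A) = (1 / l) *\<^sub>R matrix_inv A"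
proof -
  have "((1 / l) *\<^sub>R matrix_inv A) ** (l *\<^sub>R A) = mat 1"
    using assms invertible_matrix_inv[OF assms(1)] by (simp add: matrix_scalar_ac)
  moreover have "(l *\<^sub>R A) ** matrix_inv (l *\<^sub>R A) = mat 1"
    using assms by (intro invertible_matrix_inv scalar_invertible)
  ultimately show ?thesis
    by (metis matrix_mul_assoc matrix_mul_lid matrix_mul_rid)
qed

text \<open>The inverse metric contributes \<open>1 / l\<close> and each first derivative of the
  metric \<open>l / m\<close>, so \<open>l\<close> cancels.\<close>

lemma christoffel_affine_conj:
  fixes g h :: "real^'n::finite \<Rightarrow> real^'n^'n"
  assumes U: "open U" "p \<in> U" and m: "m \<noteq> 0" and l: "l \<noteq> 0"
    and h: "\<And>x. x \<in> U \<Longrightarrow> h (m *\<^sub>R x + q) = l *\<^sub>R g x"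
    and diff: "\<And>i j. (\<lambda>x. g x $ i $ j) differentiable (at p)"
    and inv: "invertible (g p)"
  shows "christoffel h k i j (m *\<^sub>R p + q) = christoffel g k i j p / m"
proof -
  have partial: "partial i (\<lambda>x. h x $ j $ k) (m *\<^sub>R p + q) = l / m * partial i (\<lambda>x. g x $ j $ k) p"
    for i j k
    using U m _ diff by (rule partial_affine_conj) (simp add: h)
  show ?thesis
    unfolding christoffel_def partial h[OF U(2)] matrix_inv_scaleR[OF inv l] sum_divide_distrib
    using l m by (intro sum.cong refl) (simp add: field_simps)
qed

text \<open>The acceleration is multiplied by \<open>m\<close>. The quadratic term is multiplied by
  \<open>m\<close> as well: \<open>1 / m\<close> from the Christoffel symbols and \<open>m\<close>
  from each of the two velocities. So the geodesic equation is multiplied by \<open>m\<close>, in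
  the same parameter.\<close>

lemma geodesic_on_affine_conj:
  fixes g h :: "real^'n::finite \<Rightarrow> real^'n^'n"
  assumes U: "open U" and m: "m \<noteq> 0" and l: "l \<noteq> 0"
    and h: "\<And>x. x \<in> U \<Longrightarrow> h (m *\<^sub>R x + q) = l *\<^sub>R g x"
    and diff: "\<And>p i j. p \<in> U \<Longrightarrow> (\<lambda>x. g x $ i $ j) differentiable (at p)"
    and inv: "\<And>p. p \<in> U \<Longrightarrow> invertible (g p)"
    and geo: "geodesic_on U g I \<gamma>"
  shows "geodesic_on ((\<lambda>x. m *\<^sub>R x + q) ` U) h I (\<lambda>s. m *\<^sub>R \<gamma> s + q)"
proof -
  from geo obtain \<gamma>' \<gamma>'' where sub: "\<gamma> ` I \<subseteq> U"
    and d1: "\<And>s. s \<in> I \<Longrightarrow> (\<gamma> has_vector_derivative \<gamma>' s) (at s)"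
    and d2: "\<And>s. s \<in> I \<Longrightarrow> (\<gamma>' has_vector_derivative \<gamma>'' s) (at s)"
    and eq: "\<And>s k. s \<in> I \<Longrightarrow> \<gamma>'' s $ k +
              (\<Sum>i\<in>UNIV. \<Sum>j\<in>UNIV. christoffel g k i j (\<gamma> s) * \<gamma>' s $ i * \<gamma>' s $ j) = 0"
    unfolding geodesic_on_def by blast
  have 1: "((\<lambda>s. m *\<^sub>R \<gamma> s + q) has_vector_derivative m *\<^sub>R \<gamma>' s) (at s)" if "s \<in> I" for s
    using d1[OF that] by (auto intro!: derivative_eq_intros)
  have 2: "((\<lambda>s. m *\<^sub>R \<gamma>' s) has_vector_derivative m *\<^sub>R \<gamma>'' s) (at s)" if "s \<in> I" for s
    using d2[OF that] by (auto intro!: derivative_eq_intros)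
  have 3: "(m *\<^sub>R \<gamma>'' s) $ k + (\<Sum>i\<in>UNIV. \<Sum>j\<in>UNIV. christoffel h k i j (m *\<^sub>R \<gamma> s + q) *
      (m *\<^sub>R \<gamma>' s) $ i * (m *\<^sub>R \<gamma>' s) $ j) = 0" if s: "s \<in> I" for s k
  proof -
    have chr: "christoffel h k i j (m *\<^sub>R \<gamma> s + q) = christoffel g k i j (\<gamma> s) / m" for i j
      using sub s by (intro christoffel_affine_conj[OF U _ m l h diff inv]) auto
    have "(m *\<^sub>R \<gamma>'' s) $ k + (\<Sum>i\<in>UNIV. \<Sum>j\<in>UNIV. christoffel h k i j (m *\<^sub>R \<gamma> s + q) *
        (m *\<^sub>R \<gamma>' s) $ i * (m *\<^sub>R \<gamma>' s) $ j) = m * (\<gamma>'' s $ k +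
        (\<Sum>i\<in>UNIV. \<Sum>j\<in>UNIV. christoffel g k i j (\<gamma> s) * \<gamma>' s $ i * \<gamma>' s $ j))"
      unfolding chr distrib_left sum_distrib_left
      using m by (simp add: field_simps)
    then show ?thesis using eq[OF s] by simp
  qed
  show ?thesis
    unfolding geodesic_on_def using sub 1 2 3
    by (intro conjI exI[of _ "\<lambda>s. m *\<^sub>R \<gamma>' s"] exI[of _ "\<lambda>s. m *\<^sub>R \<gamma>'' s"]) auto
qed

text \<open>The reparametrization \<open>\<tau>\<close> that turns \<open>c\<close> into a geodesic
  of \<open>g\<close> also serves the image curve. Its velocity is multiplied by the nonzero
  \<open>m\<close>, so it stays regular.\<close>

lemma projective_map_affine:
  fixes g h :: "real^'n::finite \<Rightarrow> real^'n^'n"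
  assumes U: "open U" and m: "m \<noteq> 0" and l: "l \<noteq> 0"
    and h: "\<And>x. x \<in> U \<Longrightarrow> h (m *\<^sub>R x + q) = l *\<^sub>R g x"
    and diff: "\<And>p i j. p \<in> U \<Longrightarrow> (\<lambda>x. g x $ i $ j) differentiable (at p)"
    and inv: "\<And>p. p \<in> U \<Longrightarrow> invertible (g p)"
  shows "projective_map U g ((\<lambda>x. m *\<^sub>R x + q) ` U) h (\<lambda>x. m *\<^sub>R x + q)"
  unfolding projective_map_def
proof (intro conjI allI impI smooth_on_affine order.refl)
  fix I c
  assume "unparametrized_geodesic U g I c"
  then obtain J \<tau> where I: "open_interval I" "open_interval J" "bij_betw \<tau> J I"
      "smooth_on J \<tau>" "\<forall>s\<in>J. deriv \<tau> s \<noteq> 0"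
    and geo: "geodesic_on U g J (c \<circ> \<tau>)"
    and nz: "\<forall>s\<in>J. vector_derivative (c \<circ> \<tau>) (at s) \<noteq> 0"
    unfolding unparametrized_geodesic_def by blast
  have comp: "(\<lambda>x. m *\<^sub>R x + q) \<circ> c \<circ> \<tau> = (\<lambda>s. m *\<^sub>R (c \<circ> \<tau>) s + q)"
    by auto
  have "vector_derivative (\<lambda>s. m *\<^sub>R (c \<circ> \<tau>) s + q) (at s) \<noteq> 0" if s: "s \<in> J" for s
  proof -
    \<comment> \<open>\<open>vector_derivative\<close> is a choice operator, so an actual derivative
      is first taken from the geodesic property; both values can then be compared.\<close>
    obtain d where d: "((c \<circ> \<tau>) has_vector_derivative d) (at s)"
      using geo s unfolding geodesic_on_def by blast
    then have "((\<lambda>s. m *\<^sub>R (c \<circ> \<tau>) s + q) has_vector_derivative m *\<^sub>R d) (at s)"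
      by (auto intro!: derivative_eq_intros simp del: o_apply)
    then have "vector_derivative (\<lambda>s. m *\<^sub>R (c \<circ> \<tau>) s + q) (at s) = m *\<^sub>R d"
      by (rule vector_derivative_at)
    with nz s m vector_derivative_at[OF d] show ?thesis by (simp del: o_apply) blast
  qed
  moreover have "geodesic_on ((\<lambda>x. m *\<^sub>R x + q) ` U) h J (\<lambda>s. m *\<^sub>R (c \<circ> \<tau>) s + q)"
    using U m l h diff inv geo by (rule geodesic_on_affine_conj)
  ultimately show "unparametrized_geodesic ((\<lambda>x. m *\<^sub>R x + q) ` U) h I ((\<lambda>x. m *\<^sub>R x + q) \<circ> c)"
    unfolding unparametrized_geodesic_def using I
    by (intro conjI exI[of _ J] exI[of _ \<tau>]) (auto simp only: comp)
qed

text \<open>The Jacobian is \<open>m\<close> times the identity, and it enters the pullback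
  twice.\<close>

lemma pullback_metric_affine:
  fixes h :: "real^'n::finite \<Rightarrow> real^'n^'n"
  shows "pullback_metric (\<lambda>x. m *\<^sub>R x + q) h p = m\<^sup>2 *\<^sub>R h (m *\<^sub>R p + q)"
proof -
  have "((\<lambda>x. m *\<^sub>R x + q) has_derivative (*\<^sub>R) m) (at p)"
    by (auto intro!: derivative_eq_intros)
  then have "matrix (frechet_derivative (\<lambda>x. m *\<^sub>R x + q) (at p)) = m *\<^sub>R mat 1"
    using frechet_derivative_at by (force simp: matrix_def mat_def axis_def vec_eq_iff)
  then show ?thesis
    by (simp add: pullback_metric_def transpose_scalar power2_eq_square
        scalar_matrix_assoc[symmetric] matrix_scalar_ac)
qed


section \<open>Flows of the symmetry fields\<close>

text \<open>Equals \<open>\<integral>\<^sub>0\<^sup>t exp (c s) ds\<close>.\<close>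

definition exp_primitive :: "real \<Rightarrow> real \<Rightarrow> real"
  where "exp_primitive c t = (if c = 0 then t else (exp (c * t) - 1) / c)"

lemma exp_primitive_0 [simp]: "exp_primitive c 0 = 0"
  by (simp add: exp_primitive_def)

lemma has_real_derivative_exp_primitive:
  "(exp_primitive c has_real_derivative exp (c * t)) (at t within S)"
proof (cases "c = 0")
  case True
  then have "exp_primitive c = (\<lambda>t. t)" by (auto simp: exp_primitive_def)
  with True show ?thesis by simp
next
  case False
  then have "exp_primitive c = (\<lambda>t. (exp (c * t) - 1) / c)" by (auto simp: exp_primitive_def)
  with False show ?thesis by (auto intro!: derivative_eq_intros)
qed

text \<open>Integrated form of \<open>(exp (c * t))' = c * exp (c * t)\<close>. It also covers
  \<open>c = 0\<close>, so the computations below need no case distinction.\<close>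

lemma exp_eq_exp_primitive: "exp (c * t) = 1 + c * exp_primitive c t"
  by (simp add: exp_primitive_def)

text \<open>Variation of constants for \<open>x' = c x + w\<close>: a homogeneous solution starting
  at \<open>z\<close> plus a particular solution vanishing at \<open>0\<close>.\<close>

lemma affine_ode_solution:
  "((\<lambda>s. exp (c * s) *\<^sub>R z + exp_primitive c s *\<^sub>R w) has_vector_derivative
     c *\<^sub>R (exp (c * s) *\<^sub>R z + exp_primitive c s *\<^sub>R w) + w) (at s within S)"
proof -
  have "((\<lambda>s. exp (c * s) *\<^sub>R z + exp_primitive c s *\<^sub>R w) has_vector_derivative
     (c * exp (c * s)) *\<^sub>R z + exp (c * s) *\<^sub>R w) (at s within S)"
    by (auto intro!: derivative_eq_intros has_real_derivative_exp_primitive)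
  also have "(c * exp (c * s)) *\<^sub>R z + exp (c * s) *\<^sub>R w =
      c *\<^sub>R (exp (c * s) *\<^sub>R z + exp_primitive c s *\<^sub>R w) + w"
    by (simp add: exp_eq_exp_primitive algebra_simps)
  finally show ?thesis .
qed

text \<open>The difference from the explicit solution satisfies the homogeneous equation. Multiplied
  by the integrating factor \<open>exp (- c * s)\<close> it has zero derivative, so it is constant
  on the convex set \<open>S\<close>, and it vanishes at \<open>0\<close>.\<close>

lemma affine_ode_unique:
  fixes x :: "real \<Rightarrow> 'a::real_normed_vector"
  assumes S: "convex S" "0 \<in> S" "s \<in> S"
    and x: "\<And>s. s \<in> S \<Longrightarrow> (x has_vector_derivative c *\<^sub>R x s + w) (at s within S)"
  shows "x s = exp (c * s) *\<^sub>R x 0 + exp_primitive c s *\<^sub>R w"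
proof -
  let ?y = "\<lambda>s. exp (c * s) *\<^sub>R x 0 + exp_primitive c s *\<^sub>R w"
  define D where "D s = exp (- c * s) *\<^sub>R (x s - ?y s)" for s
  have "(D has_vector_derivative 0) (at s within S)"
    if "s \<in> S" for s
  proof -
    have "((\<lambda>s. x s - ?y s) has_vector_derivative c *\<^sub>R (x s - ?y s)) (at s within S)"
      using has_vector_derivative_diff[OF x[OF that] affine_ode_solution[of c "x 0" w s S]]
      by (simp add: algebra_simps)
    moreover have "((\<lambda>s. exp (- c * s)) has_real_derivative - c * exp (- c * s)) (at s within S)"
      by (auto intro!: derivative_eq_intros)
    ultimately show ?thesis
      by (auto dest: has_vector_derivative_scaleR simp: D_def[abs_def] algebra_simps)
  qed
  then have "D s = D 0"
  proof (rule has_vector_derivative_zero_constant[OF S(1)])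
    fix k
    assume k: "\<And>s. s \<in> S \<Longrightarrow> D s = k"
    show "D s = D 0"
      using k[OF S(2)] k[OF S(3)] by simp
  qed
  then show ?thesis by (simp add: D_def)
qed

text \<open>The field decouples into an affine equation for the first component and a linear one for
  the second. The explicit solution and its uniqueness on the segment from \<open>0\<close> to
  \<open>t\<close>, for either sign of \<open>t\<close>, justify the definite description.\<close>

lemma exp_flow_affine:
  fixes z :: "'a::real_normed_vector \<times> 'b::real_normed_vector"
  assumes X: "\<And>z. X z = (c *\<^sub>R fst z + w, d *\<^sub>R snd z)"
  shows "exp_flow X t z = (exp (c * t) *\<^sub>R fst z + exp_primitive c t *\<^sub>R w, exp (d * t) *\<^sub>R snd z)"
  unfolding exp_flow_def
proof (rule the_equality)
  let ?\<gamma> = "\<lambda>s. (exp (c * s) *\<^sub>R fst z + exp_primitive c s *\<^sub>R w, exp (d * s) *\<^sub>R snd z)"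
  have "(?\<gamma> has_vector_derivative X (?\<gamma> s)) (at s within S)" for s S
    unfolding X fst_conv snd_conv
    \<comment> \<open>The second component is the affine equation with zero inhomogeneous
      term.\<close>
    using affine_ode_solution[of d "snd z" 0 s S]
    by (intro has_vector_derivative_Pair affine_ode_solution) simp
  then show "\<exists>\<gamma>. \<gamma> 0 = z \<and> \<gamma> t = ?\<gamma> t \<and>
      (\<forall>s\<in>closed_segment 0 t. (\<gamma> has_vector_derivative X (\<gamma> s)) (at s within closed_segment 0 t))"
    by (intro exI[of _ ?\<gamma>]) auto
next
  fix y
  assume "\<exists>\<gamma>. \<gamma> 0 = z \<and> \<gamma> t = y \<and>
      (\<forall>s\<in>closed_segment 0 t. (\<gamma> has_vector_derivative X (\<gamma> s)) (at s within closed_segment 0 t))"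
  then obtain \<gamma> where \<gamma>: "\<gamma> 0 = z" "\<gamma> t = y"
    and d: "\<And>s. s \<in> closed_segment 0 t \<Longrightarrow>
      (\<gamma> has_vector_derivative X (\<gamma> s)) (at s within closed_segment 0 t)"
    by blast
  have "((fst \<circ> \<gamma>) has_vector_derivative c *\<^sub>R (fst \<circ> \<gamma>) s + w) (at s within closed_segment 0 t)"
    "((snd \<circ> \<gamma>) has_vector_derivative d *\<^sub>R (snd \<circ> \<gamma>) s + 0) (at s within closed_segment 0 t)"
    if "s \<in> closed_segment 0 t" for s
    using bounded_linear.has_vector_derivative[OF bounded_linear_fst d[OF that]]
      bounded_linear.has_vector_derivative[OF bounded_linear_snd d[OF that]]
    by (simp_all add: X o_def)
  then have "(fst \<circ> \<gamma>) t = exp (c * t) *\<^sub>R (fst \<circ> \<gamma>) 0 + exp_primitive c t *\<^sub>R w"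
    "(snd \<circ> \<gamma>) t = exp (d * t) *\<^sub>R (snd \<circ> \<gamma>) 0 + exp_primitive d t *\<^sub>R 0"
    using affine_ode_unique[of "closed_segment 0 t" t]
    by (blast intro: convex_closed_segment ends_in_segment)+
  then show "y = (exp (c * t) *\<^sub>R fst z + exp_primitive c t *\<^sub>R w, exp (d * t) *\<^sub>R snd z)"
    using \<gamma> by (simp add: prod_eq_iff)
qed

text \<open>Both translations and the dilation move only \<open>(u, v)\<close>, and the scaling
  moves only \<open>(E, F, G)\<close>. With coefficients \<open>c\<close> of the dilation and
  \<open>d\<close> of the scaling, the factors are \<open>m = exp (c * t)\<close> and
  \<open>l = exp (d * t)\<close>, hence positive.\<close>

lemma exp_flow_symmetry_fields:
  assumes "X \<in> symmetry_fields"
  shows "\<exists>m>0. \<exists>l>0. \<exists>q. \<forall>z. exp_flow X t z = (m *\<^sub>R fst z + q, l *\<^sub>R snd z)"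
proof -
  from assms obtain a b c d where X: "X = (\<lambda>z.
      a *\<^sub>R field_u z + b *\<^sub>R field_v z + c *\<^sub>R field_dilation z + d *\<^sub>R field_scaling z)"
    unfolding symmetry_fields_def by blast
  have "X z = (c *\<^sub>R fst z + (a *\<^sub>R axis 1 1 + b *\<^sub>R axis 2 1), d *\<^sub>R snd z)" for z
    by (cases z) (simp add: X field_u_def field_v_def field_dilation_def field_scaling_def)
  from exp_flow_affine[of X, OF this] show ?thesis
    by (intro exI[of _ "exp (c * t)"] exI[of _ "exp (d * t)"] conjI) auto
qed

section \<open>Solutions and their surfaces under affine scalings\<close>

lemma metric_solution_affine_conj:
  assumes sol: "metric_solution U E F G" and m: "m > 0" and l: "l > 0"
    and E: "\<And>x. x \<in> U \<Longrightarrow> E' (m *\<^sub>R x + q) = l * E x"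
    and F: "\<And>x. x \<in> U \<Longrightarrow> F' (m *\<^sub>R x + q) = l * F x"
    and G: "\<And>x. x \<in> U \<Longrightarrow> G' (m *\<^sub>R x + q) = l * G x"
  shows "metric_solution ((\<lambda>x. m *\<^sub>R x + q) ` U) E' F' G'"
proof -
  from sol have U: "open U" and smooth: "smooth_on U E" "smooth_on U F" "smooth_on U G"
    and pos: "\<And>p. p \<in> U \<Longrightarrow> E p > 0 \<and> E p * G p - (F p)\<^sup>2 > 0"
    and eqs: "\<And>p. p \<in> U \<Longrightarrow>
        2 * E p * partial 1 F p - F p * partial 1 E p - E p * partial 2 E p = 0 \<and>
        2 * G p * partial 2 F p - F p * partial 2 G p - G p * partial 1 G p = 0 \<and>
        G p * partial 1 E p + E p * partial 2 G p - 2 * F p * (partial 1 F p + partial 2 F p)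
          + (3 * F p - 2 * G p) * partial 2 E p + (3 * F p - 2 * E p) * partial 1 G p = 0"
    unfolding metric_solution_def by blast+
  note diff = smooth[THEN smooth_on_imp_differentiable]
  show ?thesis
    unfolding metric_solution_def
  proof (intro conjI open_affine_image U)
    show "smooth_on ((\<lambda>x. m *\<^sub>R x + q) ` U) E'" "smooth_on ((\<lambda>x. m *\<^sub>R x + q) ` U) F'"
      "smooth_on ((\<lambda>x. m *\<^sub>R x + q) ` U) G'"
      using smooth m E F G by (auto intro!: smooth_on_affine_conj[OF U, where l = l])
  next
    have "l * E p > 0 \<and> (l * E p) * (l * G p) - (l * F p)\<^sup>2 > 0" if "p \<in> U" for p
    proof -
      have "(l * E p) * (l * G p) - (l * F p)\<^sup>2 = l\<^sup>2 * (E p * G p - (F p)\<^sup>2)"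
        by (simp add: algebra_simps power2_eq_square)
      then show ?thesis using pos[OF that] l by simp
    qed
    then show "\<forall>p\<in>(\<lambda>x. m *\<^sub>R x + q) ` U. E' p > 0 \<and> E' p * G' p - (F' p)\<^sup>2 > 0"
      using E F G by auto
  next
    show "\<forall>p\<in>(\<lambda>x. m *\<^sub>R x + q) ` U.
        2 * E' p * partial 1 F' p - F' p * partial 1 E' p - E' p * partial 2 E' p = 0 \<and>
        2 * G' p * partial 2 F' p - F' p * partial 2 G' p - G' p * partial 1 G' p = 0 \<and>
        G' p * partial 1 E' p + E' p * partial 2 G' p - 2 * F' p * (partial 1 F' p + partial 2 F' p)
          + (3 * F' p - 2 * G' p) * partial 2 E' p + (3 * F' p - 2 * E' p) * partial 1 G' p = 0"
    proof (clarify, intro conjI)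
      fix p assume p: "p \<in> U"
      have partial:
        "partial i E' (m *\<^sub>R p + q) = l / m * partial i E p"
        "partial i F' (m *\<^sub>R p + q) = l / m * partial i F p"
        "partial i G' (m *\<^sub>R p + q) = l / m * partial i G p" for i
        using m E F G diff[OF p] by (simp_all add: partial_affine_conj[OF U p] del: times_divide_eq_left)
      note e = eqs[OF p, THEN conjunct1] eqs[OF p, THEN conjunct2, THEN conjunct1]
        eqs[OF p, THEN conjunct2, THEN conjunct2]
      note pulled = partial E[OF p] F[OF p] G[OF p]
      let ?p = "m *\<^sub>R p + q"
      \<comment> \<open>In all three equations the common factor is \<open>l * (l / m)\<close>:
        \<open>l\<close> from the undifferentiated coefficient and \<open>l / m\<close> from the
        first derivative. Multiplying the equation at \<open>p\<close> by it gives the equation at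
        \<open>?p\<close>.\<close>
      show "2 * E' ?p * partial 1 F' ?p - F' ?p * partial 1 E' ?p - E' ?p * partial 2 E' ?p = 0"
        unfolding pulled using arg_cong[OF e(1), of "(*) (l * (l / m))"] by (simp add: algebra_simps)
      show "2 * G' ?p * partial 2 F' ?p - F' ?p * partial 2 G' ?p - G' ?p * partial 1 G' ?p = 0"
        unfolding pulled using arg_cong[OF e(2), of "(*) (l * (l / m))"] by (simp add: algebra_simps)
      show "G' ?p * partial 1 E' ?p + E' ?p * partial 2 G' ?p
          - 2 * F' ?p * (partial 1 F' ?p + partial 2 F' ?p)
          + (3 * F' ?p - 2 * G' ?p) * partial 2 E' ?p
          + (3 * F' ?p - 2 * E' ?p) * partial 1 G' ?p = 0"
        unfolding pulled using arg_cong[OF e(3), of "(*) (l * (l / m))"] by (simp add: algebra_simps)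
    qed
  qed (use m in auto)
qed

lemma metric_solution_differentiable:
  assumes "metric_solution U E F G" "p \<in> U"
  shows "(\<lambda>x. metric_of E F G x $ i $ j) differentiable (at p)"
  using assms exhaust_2[of i] exhaust_2[of j]
  by (auto simp: metric_solution_def metric_of_def smooth_on_imp_differentiable)

text \<open>The determinant of the Gram matrix is \<open>E G - F^2\<close>, which is positive for a
  solution.\<close>

lemma metric_solution_invertible:
  assumes "metric_solution U E F G" "p \<in> U"
  shows "invertible (metric_of E F G p)"
  using assms
  by (force simp: metric_solution_def metric_of_def invertible_det_nz det_2 power2_eq_square)

text \<open>Projecting to the \<open>(u, v)\<close>-plane recovers the domain, and a point of a
  graph is determined by its base point. Read backwards, this verifies a proposed graph of the moved
  surface; read forwards, it reads off the domain and coefficients of a given one.\<close>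

lemma surface_eq_iff:
  "(\<lambda>z. (m *\<^sub>R fst z + q, l *\<^sub>R snd z)) ` surface U E F G = surface U' E' F' G' \<longleftrightarrow>
     U' = (\<lambda>x. m *\<^sub>R x + q) ` U \<and>
     (\<forall>x\<in>U. E' (m *\<^sub>R x + q) = l * E x \<and> F' (m *\<^sub>R x + q) = l * F x \<and> G' (m *\<^sub>R x + q) = l * G x)"
  (is "?L = ?R \<longleftrightarrow> _")
proof (intro iffI conjI ballI)
  assume eq: "?L = ?R"
  have "fst ` ?L = (\<lambda>x. m *\<^sub>R x + q) ` U" "fst ` ?R = U'"
    by (simp_all add: surface_def graph_point_def image_image)
  with eq show "U' = (\<lambda>x. m *\<^sub>R x + q) ` U" by simp
  fix x assume "x \<in> U"
  then have "(m *\<^sub>R x + q, l * E x, l * F x, l * G x) \<in> ?L"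
    by (force simp: surface_def graph_point_def)
  then have "(m *\<^sub>R x + q, l * E x, l * F x, l * G x) \<in> ?R"
    using eq by simp
  then show "E' (m *\<^sub>R x + q) = l * E x" "F' (m *\<^sub>R x + q) = l * F x" "G' (m *\<^sub>R x + q) = l * G x"
    by (auto simp: surface_def graph_point_def)
next
  assume "U' = (\<lambda>x. m *\<^sub>R x + q) ` U \<and>
     (\<forall>x\<in>U. E' (m *\<^sub>R x + q) = l * E x \<and> F' (m *\<^sub>R x + q) = l * F x \<and> G' (m *\<^sub>R x + q) = l * G x)"
  then show "?L = ?R"
    by (force simp: surface_def graph_point_def image_image)
qed

section \<open>Projectivity and homothety of the induced map\<close>

theorem theorem3:
  fixes U :: "(real^2) set" and E F G :: "real^2 \<Rightarrow> real" and X :: "jet \<Rightarrow> jet"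
  assumes "metric_solution U E F G"
    and "X \<in> symmetry_fields"
  shows "(\<exists>\<epsilon>>0. \<forall>t. \<bar>t\<bar> < \<epsilon> \<longrightarrow>
            (\<exists>Ut Et Ft Gt. metric_solution Ut Et Ft Gt \<and>
               exp_flow X t ` surface U E F G = surface Ut Et Ft Gt)) \<and>
         (\<forall>t Ut Et Ft Gt. metric_solution Ut Et Ft Gt \<and>
            exp_flow X t ` surface U E F G = surface Ut Et Ft Gt \<longrightarrow>
              projective_map U (metric_of E F G) Ut (metric_of Et Ft Gt)
                (induced_map X t E F G) \<and>
              (\<not> isometry_map U (metric_of E F G) Ut (metric_of Et Ft Gt)
                   (induced_map X t E F G) \<longrightarrow>
               homothety_map U (metric_of E F G) Ut (metric_of Et Ft Gt)
                 (induced_map X t E F G)))"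
proof (intro conjI)
  have "\<exists>Ut Et Ft Gt. metric_solution Ut Et Ft Gt \<and>
      exp_flow X t ` surface U E F G = surface Ut Et Ft Gt" for t
  proof -
    obtain m l q where m: "m > 0" and l: "l > 0"
      and "\<forall>z. exp_flow X t z = (m *\<^sub>R fst z + q, l *\<^sub>R snd z)"
      using exp_flow_symmetry_fields[OF assms(2)] by metis
    then have flow: "exp_flow X t = (\<lambda>z. (m *\<^sub>R fst z + q, l *\<^sub>R snd z))"
      by auto
    \<comment> \<open>Transport of a coefficient along the inverse of the base map, followed by the
      fibre scaling; on the image of \<open>U\<close> these are the values that the moved surface
      forces.\<close>
    define pull where "pull f y = l * f (inverse m *\<^sub>R (y - q))" for f :: "real^2 \<Rightarrow> real" and y
    have pull: "pull f (m *\<^sub>R x + q) = l * f x" for f x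
      using m by (simp add: pull_def)
    have "metric_solution ((\<lambda>x. m *\<^sub>R x + q) ` U) (pull E) (pull F) (pull G)"
      using assms(1) m l pull pull pull by (rule metric_solution_affine_conj)
    moreover have "exp_flow X t ` surface U E F G =
        surface ((\<lambda>x. m *\<^sub>R x + q) ` U) (pull E) (pull F) (pull G)"
      unfolding flow surface_eq_iff by (simp add: pull)
    ultimately show ?thesis by blast
  qed
  then show "\<exists>\<epsilon>>0. \<forall>t. \<bar>t\<bar> < \<epsilon> \<longrightarrow>
            (\<exists>Ut Et Ft Gt. metric_solution Ut Et Ft Gt \<and>
               exp_flow X t ` surface U E F G = surface Ut Et Ft Gt)"
    \<comment> \<open>The flow is defined for all times and always yields a solution surface, so the
      radius \<open>1\<close> serves.\<close>
    using zero_less_one by blast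
next
  have "projective_map U (metric_of E F G) Ut (metric_of Et Ft Gt) (induced_map X t E F G) \<and>
      homothety_map U (metric_of E F G) Ut (metric_of Et Ft Gt) (induced_map X t E F G)"
    if surf: "exp_flow X t ` surface U E F G = surface Ut Et Ft Gt" for t Ut Et Ft Gt
  proof -
    obtain m l q where m: "m > 0" and l: "l > 0"
      and "\<forall>z. exp_flow X t z = (m *\<^sub>R fst z + q, l *\<^sub>R snd z)"
      using exp_flow_symmetry_fields[OF assms(2)] by metis
    then have flow: "exp_flow X t = (\<lambda>z. (m *\<^sub>R fst z + q, l *\<^sub>R snd z))"
      by auto
    have induced: "induced_map X t E F G = (\<lambda>x. m *\<^sub>R x + q)"
      by (auto simp: induced_map_def flow graph_point_def)
    \<comment> \<open>The moved surface is given only as a set of points; its equality with a graph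
      fixes both the domain and the metric there.\<close>
    have Ut: "Ut = (\<lambda>x. m *\<^sub>R x + q) ` U"
      using surf unfolding flow surface_eq_iff by simp
    have h: "metric_of Et Ft Gt (m *\<^sub>R x + q) = l *\<^sub>R metric_of E F G x" if "x \<in> U" for x
      using surf that unfolding flow surface_eq_iff
      by (simp add: metric_of_def vec_eq_iff forall_2)
    have "projective_map U (metric_of E F G) Ut (metric_of Et Ft Gt) (induced_map X t E F G)"
      unfolding Ut induced
      using assms(1) m l h
      by (intro projective_map_affine[where l = l] metric_solution_differentiable[OF assms(1)]
          metric_solution_invertible[OF assms(1)]) (auto simp: metric_solution_def)
    \<comment> \<open>The homothety constant collects \<open>m\<^sup>2\<close> from the Jacobian and
      \<open>l\<close> from the scaled coefficients.\<close>
    moreover have "pullback_metric (induced_map X t E F G) (metric_of Et Ft Gt) p =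
        (m\<^sup>2 * l) *\<^sub>R metric_of E F G p" if "p \<in> U" for p
      unfolding induced pullback_metric_affine h[OF that] by simp
    ultimately show ?thesis unfolding homothety_map_def by blast
  qed
  then show "\<forall>t Ut Et Ft Gt. metric_solution Ut Et Ft Gt \<and>
            exp_flow X t ` surface U E F G = surface Ut Et Ft Gt \<longrightarrow>
              projective_map U (metric_of E F G) Ut (metric_of Et Ft Gt)
                (induced_map X t E F G) \<and>
              (\<not> isometry_map U (metric_of E F G) Ut (metric_of Et Ft Gt)
                   (induced_map X t E F G) \<longrightarrow>
               homothety_map U (metric_of E F G) Ut (metric_of Et Ft Gt)
                 (induced_map X t E F G))"
    by blast
qed

end
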